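(* Let $\mathcal X\subseteq\mathbb R^{n}$, $\mathcal Y\subseteq\mathbb R^{m}$ be nonempty closed convex sets, $A\in\mathbb R^{m\times n}$, let $f:\mathbb R^{n}\to\mathbb R$ be $L_x$-smooth and $\mu_x$-strongly convex and $h:\mathbb R^{m}\to\mathbb R$ be $L_y$-smooth and $\mu_y$-strongly convex, with $\mu_x,\mu_y>0$. Let $(x^*,y^* )$ be the solution (saddle point) of $\min_{x\in\mathcal X}\max_{y\in\mathcal Y}\,\phi(x,y)$, where $\phi(x,y)=f(x)+\langle y,Ax\rangle-h(y)$. Put $$\kappa=\sqrt{\tfrac{L_x}{\mu_x}-1}+\frac{2\|A\|}{\sqrt{\mu_x\mu_y}}+\sqrt{\tfrac{L_y}{\mu_y}-1},$$ and run the LPD algorithm (defined in the context) from $(x_0,y_0)\in\mathcal X\times\mathcal Y$ with the iteration-independent parameters $\theta_k=\theta=1/(1+\kappa^{-1})$, $\eta_{x,k}=\eta_x$, $\eta_{y,k}=\eta_y$, $\eta_{u,k}=\eta_u$, $\eta_{v,k}=\eta_v$, where $$\eta_x=\frac1{\mu_x}\Big(\sqrt{\tfrac{L_x}{\mu_x}-1}+\tfrac{2\|A\|}{\sqrt{\mu_x\mu_y}}\Big)^{-1},\quad \eta_y=\frac1{\mu_y}\Big(\sqrt{\tfrac{L_y}{\mu_y}-1}+\tfrac{2\|A\|}{\sqrt{\mu_x\mu_y}}\Big)^{-1},\quad \eta_u=\Big(\sqrt{\tfrac{L_x}{\mu_x}-1}\Big)^{-1},\quad \eta_v=\Big(\sqrt{\tfrac{L_y}{\mu_y}-1}\Big)^{-1}.$$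 Then for every integer $K>0$, $$\frac{\|A\|}{\sqrt{\mu_x\mu_y}}\Big(\frac{\mu_x}{2}\|x^*-x_K\|^2+\frac{\mu_y}{2}\|y^*-y_K\|^2\Big)\le \exp\Big(-\frac{K-1}{\kappa+1}\Big)\Big(\Big(\frac1{2\eta_x}+\frac{L_x-\mu_x}{2\eta_u}\Big)\|x^*-x_0\|^2+\Big(\frac1{2\eta_y}+\frac{L_y-\mu_y}{2\eta_v}\Big)\|y^*-y_0\|^2\Big).$$
   Context: $\|\cdot\|$ is the Euclidean norm on vectors and the operator (spectral) norm on matrices. A function is $L$-smooth if it is differentiable with $L$-Lipschitz gradient; it is $\mu$-strongly convex if it minus $\frac{\mu}{2}\|\cdot\|^2$ is convex. LPD (Lifted Primal-Dual) algorithm. Write $\underline f=f-\frac{\mu_x}{2}\|\cdot\|^2$ and $\underline h=h-\frac{\mu_y}{2}\|\cdot\|^2$. Initialize $x_{-1}=x_0=\underline x_{-1}=\underline x_0\in\mathcal X$ and $y_{-1}=y_0=\underline y_{-1}=\underline y_0\in\mathcal Y$. For $k=0,1,2,\dots$: $$\tilde x_{k+1}=x_k+\theta_k(x_k-x_{k-1}),\qquad \tilde y_{k+1}=y_k+\theta_k(y_k-y_{k-1}),$$ $$g^x_{k+1}=\nabla\underline f(\underline x_k)+\theta_k(\nabla\underline f(\underline x_k)-\nabla\underline f(\underline x_{k-1})),\qquad g^y_{k+1}=\nabla\underline h(\underline y_k)+\theta_k(\nabla\underline h(\underline y_k)-\nabla\underline h(\underline y_{k-1})),$$ $$x_{k+1}=\arg\min_{x\in\mathcal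 X}\ \langle A^\top\tilde y_{k+1}+g^x_{k+1},x\rangle+\frac1{2\eta_{x,k}}\|x-x_k\|^2+\frac{\mu_x}{2}\|x\|^2,$$ $$y_{k+1}=\arg\min_{y\in\mathcal Y}\ -\langle A\tilde x_{k+1}-g^y_{k+1},y\rangle+\frac1{2\eta_{y,k}}\|y-y_k\|^2+\frac{\mu_y}{2}\|y\|^2,$$ $$\underline x_{k+1}=\frac{\underline x_k+\eta_{u,k}x_{k+1}}{1+\eta_{u,k}},\qquad \underline y_{k+1}=\frac{\underline y_k+\eta_{v,k}y_{k+1}}{1+\eta_{v,k}}.$$ For finite positive stepsizes the $x$- and $y$-updates are the projections $x_{k+1}=P_{\mathcal X}\big((x_k-\eta_{x,k}(A^\top\tilde y_{k+1}+g^x_{k+1}))/(1+\eta_{x,k}\mu_x)\big)$ and $y_{k+1}=P_{\mathcal Y}\big((y_k+\eta_{y,k}(A\tilde x_{k+1}-g^y_{k+1}))/(1+\eta_{y,k}\mu_y)\big)$. If a stepsize formula gives $1/\eta=0$, the formulas are read with $1/\eta=0$ (e.g. $\underline x_{k+1}=x_{k+1}$ when $1/\eta_{u,k}=0$, and $\theta=\kappa/(1+\kappa)$). *)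

theory Defs
  imports "HOL-Analysis.Analysis"
begin

definition grad :: "('a::real_inner \<Rightarrow> real) \<Rightarrow> 'a \<Rightarrow> 'a" where
  "grad f x = (THE g. GDERIV f x :> g)"

definition smooth :: "real \<Rightarrow> ('a::real_inner \<Rightarrow> real) \<Rightarrow> bool" where
  "smooth L f \<longleftrightarrow> f differentiable_on UNIV \<and> L-lipschitz_on UNIV (grad f)"

definition lower :: "real \<Rightarrow> ('a::real_inner \<Rightarrow> real) \<Rightarrow> 'a \<Rightarrow> real" where
  "lower \<mu> f x = f x - \<mu> / 2 * (norm x)\<^sup>2"

definition strongly_convex :: "real \<Rightarrow> ('a::real_inner \<Rightarrow> real) \<Rightarrow> bool" where
  "strongly_convex \<mu> f \<longleftrightarrow> convex_on UNIV (lower \<mu> f)"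

definition bilinear_payoff ::
    "(real^'n \<Rightarrow> real) \<Rightarrow> (real^'m \<Rightarrow> real) \<Rightarrow> real^'n^'m \<Rightarrow> real^'n \<Rightarrow> real^'m \<Rightarrow> real" where
  "bilinear_payoff f h A x y = f x + y \<bullet> (A *v x) - h y"

definition saddle_point :: "'a set \<Rightarrow> 'b set \<Rightarrow> ('a \<Rightarrow> 'b \<Rightarrow> real) \<Rightarrow> 'a \<Rightarrow> 'b \<Rightarrow> bool" where
  "saddle_point X Y \<phi> xs ys \<longleftrightarrow> xs \<in> X \<and> ys \<in> Y \<and>
     (\<forall>x\<in>X. \<forall>y\<in>Y. \<phi> xs y \<le> \<phi> xs ys \<and> \<phi> xs ys \<le> \<phi> x ys)"

text \<open>
  The sequences \<open>x\<close>, \<open>y\<close> are the iterates and \<open>xl\<close>, \<open>yl\<close> the (underlined) averaged iterates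
  of the Lifted Primal-Dual algorithm. The step sizes enter through their reciprocals
  \<open>rx k = 1/\<eta>\<^bsub>x,k\<^esub>\<close>, \<open>ry k = 1/\<eta>\<^bsub>y,k\<^esub>\<close>, \<open>ru k = 1/\<eta>\<^bsub>u,k\<^esub>\<close>, \<open>rv k = 1/\<eta>\<^bsub>v,k\<^esub>\<close>, so that an infinite step
  size is the value 0. In the averaging steps, numerator and denominator of
  \<open>(xl k + \<eta>\<^bsub>u,k\<^esub> x (k+1)) / (1 + \<eta>\<^bsub>u,k\<^esub>)\<close> have been multiplied by \<open>1/\<eta>\<^bsub>u,k\<^esub>\<close>.
  Truncated subtraction on naturals makes \<open>x (0 - 1) = x 0\<close>, which is exactly the
  initialisation convention that the iterates of index -1 and 0 coincide.
\<close>

definition lpd_iterates ::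
    "(real^'n) set \<Rightarrow> (real^'m) set \<Rightarrow> real^'n^'m \<Rightarrow> (real^'n \<Rightarrow> real) \<Rightarrow> (real^'m \<Rightarrow> real) \<Rightarrow>
     real \<Rightarrow> real \<Rightarrow> (nat \<Rightarrow> real) \<Rightarrow>
     (nat \<Rightarrow> real) \<Rightarrow> (nat \<Rightarrow> real) \<Rightarrow> (nat \<Rightarrow> real) \<Rightarrow> (nat \<Rightarrow> real) \<Rightarrow>
     (nat \<Rightarrow> real^'n) \<Rightarrow> (nat \<Rightarrow> real^'m) \<Rightarrow> (nat \<Rightarrow> real^'n) \<Rightarrow> (nat \<Rightarrow> real^'m) \<Rightarrow> bool" where
  "lpd_iterates X Y A f h \<mu>x \<mu>y \<theta> rx ry ru rv x y xl yl \<longleftrightarrow>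
     x 0 \<in> X \<and> y 0 \<in> Y \<and> xl 0 = x 0 \<and> yl 0 = y 0 \<and>
     (\<forall>k.
        let xt = x k + \<theta> k *\<^sub>R (x k - x (k - 1));
            yt = y k + \<theta> k *\<^sub>R (y k - y (k - 1));
            gx = grad (lower \<mu>x f) (xl k)
                 + \<theta> k *\<^sub>R (grad (lower \<mu>x f) (xl k) - grad (lower \<mu>x f) (xl (k - 1)));
            gy = grad (lower \<mu>y h) (yl k)
                 + \<theta> k *\<^sub>R (grad (lower \<mu>y h) (yl k) - grad (lower \<mu>y h) (yl (k - 1)))
        in is_arg_min
             (\<lambda>z. (transpose A *v yt + gx) \<bullet> z
                  + rx k / 2 * (norm (z - x k))\<^sup>2 + \<mu>x / 2 * (norm z)\<^sup>2)
             (\<lambda>z. z \<in> X) (x (k + 1)) \<and>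
           is_arg_min
             (\<lambda>z. - ((A *v xt - gy) \<bullet> z)
                  + ry k / 2 * (norm (z - y k))\<^sup>2 + \<mu>y / 2 * (norm z)\<^sup>2)
             (\<lambda>z. z \<in> Y) (y (k + 1)) \<and>
           xl (k + 1) = (1 / (ru k + 1)) *\<^sub>R (ru k *\<^sub>R xl k + x (k + 1)) \<and>
           yl (k + 1) = (1 / (rv k + 1)) *\<^sub>R (rv k *\<^sub>R yl k + y (k + 1)))"

end

theory Submission
  imports Defs
begin

text \<open>
  The proof is a Lyapunov argument. Write \<open>F\<close> for \<open>f\<close> with its quadratic part removed,
  \<open>u\<^sub>k\<close> for the gradient of \<open>F\<close> at the averaged iterate \<open>p\<^sub>k\<close>, and \<open>D\<close> for the Bregman distance of \<open>F\<close>.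
  The averaging step is a proximal step of the dual variable \<open>u\<close> for the conjugate \<open>F\<^sup>*\<close>, since
  \<open>p\<close> is the gradient of \<open>F\<^sup>*\<close> at \<open>u\<close> and the Bregman distance of \<open>F\<^sup>*\<close> is \<open>D\<close> with its arguments exchanged. So
  LPD is a primal-dual method for a saddle problem all of whose couplings are bilinear: \<open>x\<close>
  is coupled to \<open>u\<close> by the identity and to \<open>y\<close> by \<open>A\<close>, and likewise for \<open>y\<close>. The conjugate
  serves only as motivation: everything below is expressed through \<open>D\<close>.
  
  For one block, add the variational inequality of the proximal step at \<open>x\<^sup>*\<close>, the optimality
  condition of \<open>x\<^sup>*\<close> and the three-point identity of the averaging step (\<open>bregman_averaging\<close>).
  The new distance to the solution then
  carries at least \<open>1 + 1/\<kappa> = 1/\<theta>\<close> times the weight of the old one, because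
  \<open>a + c \<le> \<kappa>\<close>, where \<open>a = sqrt (L/\<mu> - 1)\<close> and \<open>c = 2 \<parallel>A\<parallel> / sqrt (\<mu>\<^sub>x \<mu>\<^sub>y)\<close>. What remains are
  inner products of increments and errors. Extrapolation by \<open>\<theta>\<close> makes the products of an increment with an
  error telescope at the rate \<open>\<theta>\<close>, so that they can join the Lyapunov function. The
  leftover products of two increments are absorbed by the decrease of the two proximal steps: the
  step size parameter \<open>r = \<mu> (a + c)\<close> spends its share \<open>\<mu> a\<close> on the coupling to \<open>u\<close>, by the
  Young inequality \<open>grad_diff_inner_le_bregman\<close>, and its share \<open>\<mu> c\<close> on the coupling
  through \<open>A\<close>, by \<open>coupling_le\<close>.
  
  The resulting potential shrinks by \<open>\<theta>\<close> in each step (\<open>potential_step\<close>) and dominates the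
  weighted squared distance to the saddle point (\<open>potential_lower\<close>). Its initial value has the factor
  \<open>1/\<theta>\<close>, which is why the exponent is \<open>K - 1\<close>. If \<open>A = 0\<close>, the left-hand side vanishes,
  and otherwise \<open>\<kappa> > 0\<close>.
\<close>

section \<open>Gradients and Bregman distances\<close>

definition bregman :: "('a::real_inner \<Rightarrow> real) \<Rightarrow> 'a \<Rightarrow> 'a \<Rightarrow> real" where
  "bregman F p q = F p - F q - grad F q \<bullet> (p - q)"

lemma GDERIV_unique:
  assumes "GDERIV f x :> g" "GDERIV f x :> g'"
  shows "g = g'"
proof -
  have "(\<lambda>h. h \<bullet> g) = (\<lambda>h. h \<bullet> g')"
    using assms unfolding gderiv_def by (rule has_derivative_unique)
  then have "(g - g') \<bullet> (g - g') = 0"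
    by (metis inner_diff_right right_minus_eq)
  then show ?thesis by simp
qed

lemma grad_eqI: "GDERIV f x :> g \<Longrightarrow> grad f x = g"
  unfolding grad_def by (blast intro: the_equality GDERIV_unique)

lemma GDERIV_grad:
  fixes f :: "'a::euclidean_space \<Rightarrow> real"
  assumes "f differentiable (at x)"
  shows "GDERIV f x :> grad f x"
proof -
  obtain f' where f': "(f has_derivative f') (at x)"
    using assms unfolding differentiable_def by blast
  then have lin: "linear f'" by (rule has_derivative_linear)
  have "f' = (\<lambda>h. h \<bullet> adjoint f' 1)"
    using adjoint_works[OF lin, of _ 1] by auto
  with f' have "GDERIV f x :> adjoint f' 1" unfolding gderiv_def by simp
  with grad_eqI show ?thesis by metis
qed

lemma smooth_GDERIV_grad:
  fixes f :: "'a::euclidean_space \<Rightarrow> real"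
  assumes "smooth L f"
  shows "GDERIV f x :> grad f x"
  using assms by (auto simp: smooth_def differentiable_on_def intro: GDERIV_grad)

lemma GDERIV_lower:
  fixes f :: "'a::real_inner \<Rightarrow> real"
  assumes "GDERIV f x :> g"
  shows "GDERIV (lower \<mu> f) x :> g - \<mu> *\<^sub>R x"
proof -
  have "((\<lambda>x. f x - \<mu> / 2 * (x \<bullet> x)) has_derivative (\<lambda>h. h \<bullet> g - \<mu> / 2 * (x \<bullet> h + h \<bullet> x))) (at x)"
    using assms unfolding gderiv_def by (auto intro!: derivative_eq_intros)
  moreover have "lower \<mu> f = (\<lambda>x. f x - \<mu> / 2 * (x \<bullet> x))"
    by (simp add: fun_eq_iff lower_def power2_norm_eq_inner)
  moreover have "(\<lambda>h. h \<bullet> g - \<mu> / 2 * (x \<bullet> h + h \<bullet> x)) = (\<lambda>h. h \<bullet> (g - \<mu> *\<^sub>R x))"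
    by (auto simp: fun_eq_iff inner_diff_right inner_commute)
  ultimately show ?thesis unfolding gderiv_def by simp
qed

lemma grad_lower:
  fixes f :: "'a::euclidean_space \<Rightarrow> real"
  assumes "smooth L f"
  shows "grad (lower \<mu> f) x = grad f x - \<mu> *\<^sub>R x"
  using grad_eqI[OF GDERIV_lower[OF smooth_GDERIV_grad[OF assms]]] .

lemma DERIV_along_line:
  assumes "GDERIV f (p + t *\<^sub>R d) :> g"
  shows "((\<lambda>t. f (p + t *\<^sub>R d)) has_real_derivative g \<bullet> d) (at t)"
proof -
  have "((\<lambda>t. p + t *\<^sub>R d) has_derivative (\<lambda>s. s *\<^sub>R d)) (at t)"
    by (auto intro!: derivative_eq_intros)
  from has_derivative_compose[OF this assms[unfolded gderiv_def]]
  have "((\<lambda>t. f (p + t *\<^sub>R d)) has_derivative (\<lambda>s. (s *\<^sub>R d) \<bullet> g)) (at t)" .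
  moreover have "(\<lambda>s. (s *\<^sub>R d) \<bullet> g) = (*) (g \<bullet> d)"
    by (auto simp: fun_eq_iff inner_commute)
  ultimately show ?thesis unfolding has_field_derivative_def by simp
qed

text \<open>
  The tangent inequality for convex functions, obtained by restricting \<open>F\<close> to the line through
  \<open>q\<close> and \<open>p\<close>.
\<close>

lemma bregman_nonneg:
  fixes F :: "'a::real_inner \<Rightarrow> real"
  assumes conv: "convex_on UNIV F" and grad: "GDERIV F q :> grad F q"
  shows "0 \<le> bregman F p q"
proof -
  let ?\<phi> = "\<lambda>t. F (q + t *\<^sub>R (p - q))"
  have "convex_on UNIV ?\<phi>"
  proof (rule convex_onI)
    fix t u v :: real assume t: "0 < t" "t < 1"
    have "q + ((1 - t) *\<^sub>R u + t *\<^sub>R v) *\<^sub>R (p - q)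
      = (1 - t) *\<^sub>R (q + u *\<^sub>R (p - q)) + t *\<^sub>R (q + v *\<^sub>R (p - q))"
      by (simp add: algebra_simps)
    then show "?\<phi> ((1 - t) *\<^sub>R u + t *\<^sub>R v) \<le> (1 - t) * ?\<phi> u + t * ?\<phi> v"
      using convex_onD[OF conv, of t "q + u *\<^sub>R (p - q)" "q + v *\<^sub>R (p - q)"] t by simp
  qed simp
  moreover have "(?\<phi> has_real_derivative grad F q \<bullet> (p - q)) (at 0)"
    using DERIV_along_line[of F q 0] grad by simp
  ultimately have "?\<phi> 1 - ?\<phi> 0 \<ge> grad F q \<bullet> (p - q) * (1 - 0)"
    by (intro convex_on_imp_above_tangent[where A = UNIV and f = ?\<phi>]) auto
  then show ?thesis by (simp add: bregman_def)
qed

text \<open>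
  Along the segment from \<open>q\<close> to \<open>p\<close> the Lipschitz bound on the gradient makes \<open>f\<close> minus its
  quadratic upper model nonincreasing.
\<close>

lemma smooth_bregman_le:
  fixes f :: "'a::euclidean_space \<Rightarrow> real"
  assumes "smooth L f"
  shows "bregman f p q \<le> L / 2 * (norm (p - q))\<^sup>2"
proof -
  define d where "d = p - q"
  let ?\<phi> = "\<lambda>t. f (q + t *\<^sub>R d) - t * (grad f q \<bullet> d) - L / 2 * t\<^sup>2 * (norm d)\<^sup>2"
  have "?\<phi> 1 \<le> ?\<phi> 0"
  proof (rule DERIV_nonpos_imp_nonincreasing[where f = ?\<phi> and a = 0 and b = 1])
    fix t :: real assume t: "0 \<le> t" "t \<le> 1"
    let ?D = "grad f (q + t *\<^sub>R d) \<bullet> d - grad f q \<bullet> d - L * t * (norm d)\<^sup>2"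
    have "DERIV ?\<phi> t :> ?D"
      by (auto intro!: derivative_eq_intros DERIV_along_line smooth_GDERIV_grad[OF assms])
    moreover have "norm (grad f (q + t *\<^sub>R d) - grad f q) \<le> L * (t * norm d)"
      using assms t unfolding smooth_def
      by (metis UNIV_I abs_of_nonneg add_diff_cancel_left' lipschitz_on_normD norm_scaleR)
    then have "norm (grad f (q + t *\<^sub>R d) - grad f q) * norm d \<le> L * (t * norm d) * norm d"
      by (intro mult_right_mono) auto
    with norm_cauchy_schwarz[of "grad f (q + t *\<^sub>R d) - grad f q" d]
    have "?D \<le> 0"
      by (simp add: inner_diff_left power2_eq_square algebra_simps)
    ultimately show "\<exists>y. DERIV ?\<phi> t :> y \<and> y \<le> 0" by blast
  qed simp
  then show ?thesis by (simp add: bregman_def d_def)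
qed

lemma bregman_lower:
  fixes f :: "'a::euclidean_space \<Rightarrow> real"
  assumes "smooth L f"
  shows "bregman (lower \<mu> f) p q = bregman f p q - \<mu> / 2 * (norm (p - q))\<^sup>2"
  unfolding bregman_def grad_lower[OF assms] lower_def power2_norm_eq_inner
  by (simp add: algebra_simps inner_commute)

lemma bregman_lower_nonneg:
  fixes f :: "'a::euclidean_space \<Rightarrow> real"
  assumes "smooth L f" "strongly_convex \<mu> f"
  shows "0 \<le> bregman (lower \<mu> f) p q"
proof (rule bregman_nonneg)
  show "convex_on UNIV (lower \<mu> f)" using assms(2) by (simp add: strongly_convex_def)
  show "GDERIV (lower \<mu> f) q :> grad (lower \<mu> f) q"
    using GDERIV_lower[OF smooth_GDERIV_grad[OF assms(1)]] grad_lower[OF assms(1)] by metis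
qed

lemma bregman_lower_le:
  fixes f :: "'a::euclidean_space \<Rightarrow> real"
  assumes "smooth L f"
  shows "bregman (lower \<mu> f) p q \<le> (L - \<mu>) / 2 * (norm (p - q))\<^sup>2"
  using smooth_bregman_le[OF assms, of p q] bregman_lower[OF assms, of \<mu> p q]
  by (simp add: field_simps)

text \<open>
  A Euclidean space contains a unit vector, and on it the two bounds on the Bregman distance can
  be compared. This makes the square roots in the step sizes genuine.
\<close>

lemma strong_convexity_le_smoothness:
  fixes f :: "'a::euclidean_space \<Rightarrow> real"
  assumes "smooth L f" "strongly_convex \<mu> f"
  shows "\<mu> \<le> L"
proof -
  obtain e :: 'a where "e \<in> Basis" using nonempty_Basis by blast
  then show ?thesis
    using bregman_lower_nonneg[OF assms, of e 0] bregman_lower_le[OF assms(1), of \<mu> e 0] by simp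
qed

text \<open>
  A smooth convex function satisfies \<open>D q p \<ge> \<parallel>grad F q - grad F p\<parallel>\<^sup>2 / (2 \<mu> a\<^sup>2)\<close>, and the inequality
  below is that bound followed by Young's inequality. In this form it
  also covers \<open>a = 0\<close>, where \<open>F\<close> is affine, and it follows by comparing the tangent at \<open>p\<close> with the quadratic
  upper model at \<open>q\<close> in the point \<open>q - z/a\<close>.
\<close>

lemma grad_diff_inner_le_bregman:
  fixes F :: "'a::real_inner \<Rightarrow> real"
  assumes nonneg: "\<And>p q. 0 \<le> bregman F p q"
    and upper: "\<And>p q. bregman F p q \<le> \<mu> * a\<^sup>2 / 2 * (norm (p - q))\<^sup>2"
    and "0 \<le> a"
  shows "(grad F q - grad F p) \<bullet> z \<le> a * bregman F q p + \<mu> * a / 2 * (norm z)\<^sup>2"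
proof -
  have shift: "(grad F q - grad F p) \<bullet> w - \<mu> * a\<^sup>2 / 2 * (norm w)\<^sup>2 \<le> bregman F q p" for w
    using nonneg[of "q - w" p] upper[of "q - w" q]
    by (simp add: bregman_def inner_simps)
  show ?thesis
  proof (cases "a = 0")
    case True
    \<comment> \<open>The inner product is bounded on the whole ray through \<open>z\<close>; scale it past the bound.\<close>
    let ?s = "(grad F q - grad F p) \<bullet> z"
    have "?s \<le> 0"
    proof (rule ccontr)
      assume "\<not> ?s \<le> 0"
      then show False
        using shift[of "((bregman F q p + 1) / ?s) *\<^sub>R z"] True by simp
    qed
    then show ?thesis using True by simp
  next
    case False
    with \<open>0 \<le> a\<close> have "a > 0" by simp
    have "a * ((grad F q - grad F p) \<bullet> (z /\<^sub>R a) - \<mu> * a\<^sup>2 / 2 * (norm (z /\<^sub>R a))\<^sup>2)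
        \<le> a * bregman F q p"
      using shift[of "z /\<^sub>R a"] \<open>a > 0\<close> by (intro mult_left_mono) auto
    moreover have "a * ((grad F q - grad F p) \<bullet> (z /\<^sub>R a) - \<mu> * a\<^sup>2 / 2 * (norm (z /\<^sub>R a))\<^sup>2)
        = (grad F q - grad F p) \<bullet> z - \<mu> * a / 2 * (norm z)\<^sup>2"
      using \<open>a > 0\<close> by (simp add: field_simps power2_eq_square)
    ultimately show ?thesis by simp
  qed
qed

text \<open>
  The averaging rule gives \<open>x - z = (p' - z) + a (p' - p)\<close>. The three-point identity of Bregman
  distances applied to either summand yields the claim, which is what a proximal step for the conjugate
  function with step size \<open>1/a\<close> would satisfy.
\<close>

lemma bregman_averaging:
  fixes F :: "'a::real_inner \<Rightarrow> real"
  assumes "(a + 1) *\<^sub>R p' = a *\<^sub>R p + x"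
  shows "(x - z) \<bullet> (grad F p' - grad F z)
    = bregman F z p' + (1 + a) * bregman F p' z - a * bregman F p z + a * bregman F p p'"
proof -
  have x: "x = (a + 1) *\<^sub>R p' - a *\<^sub>R p" using assms by simp
  show ?thesis unfolding x bregman_def
    by (simp add: algebra_simps inner_commute)
qed

section \<open>Variational inequalities of minimisers\<close>

lemma linear_coeff_nonneg:
  fixes c C :: real
  assumes "\<And>t. 0 < t \<Longrightarrow> t \<le> 1 \<Longrightarrow> 0 \<le> t * c + t\<^sup>2 * C"
  shows "0 \<le> c"
proof (rule ccontr)
  assume c: "\<not> 0 \<le> c"
  define t where "t = min 1 (- c / (2 * (\<bar>C\<bar> + 1)))"
  have t: "0 < t" "t \<le> 1" using c by (auto simp: t_def divide_neg_pos)
  have "t * (\<bar>C\<bar> + 1) \<le> - c / 2"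
  proof -
    have "t \<le> (- c / 2) / (\<bar>C\<bar> + 1)" by (simp add: t_def)
    then show ?thesis by (subst (asm) pos_le_divide_eq) auto
  qed
  moreover have "t * C \<le> t * (\<bar>C\<bar> + 1)" using t by (intro mult_left_mono) auto
  ultimately have "c + t * C < 0" using c by linarith
  then have "t * (c + t * C) < 0" using t by (simp add: mult_pos_neg)
  with assms[OF t] show False by (simp add: algebra_simps power2_eq_square)
qed

text \<open>
  A quadratic upper model at the minimiser, with linear part \<open>g\<close>, suffices for first-order optimality. It holds with
  equality for the proximal subproblems, and for smooth functions it is \<open>smooth_bregman_le\<close>.
\<close>

lemma constrained_minimum_variational:
  fixes \<phi> :: "'a::real_inner \<Rightarrow> real"
  assumes "convex C" "p \<in> C" "z \<in> C"
    and min: "\<And>w. w \<in> C \<Longrightarrow> \<phi> p \<le> \<phi> w"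
    and quad: "\<And>d. \<phi> (p + d) \<le> \<phi> p + g \<bullet> d + B * (norm d)\<^sup>2"
  shows "0 \<le> g \<bullet> (z - p)"
proof (rule linear_coeff_nonneg)
  fix t :: real assume t: "0 < t" "t \<le> 1"
  have "p + t *\<^sub>R (z - p) = (1 - t) *\<^sub>R p + t *\<^sub>R z" by (simp add: algebra_simps)
  also have "\<dots> \<in> C" using assms(1-3) t by (auto simp: convex_alt)
  finally have "\<phi> p \<le> \<phi> (p + t *\<^sub>R (z - p))" by (rule min)
  also have "\<dots> \<le> \<phi> p + g \<bullet> (t *\<^sub>R (z - p)) + B * (norm (t *\<^sub>R (z - p)))\<^sup>2" by (rule quad)
  finally show "0 \<le> t * (g \<bullet> (z - p)) + t\<^sup>2 * (B * (norm (z - p))\<^sup>2)"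
    by (simp add: power_mult_distrib mult.commute mult.left_commute)
qed

lemma prox_variational:
  fixes g p z q :: "'a::real_inner"
  assumes "convex C" "z \<in> C"
    and "is_arg_min (\<lambda>w. g \<bullet> w + r / 2 * (norm (w - q))\<^sup>2 + \<mu> / 2 * (norm w)\<^sup>2) (\<lambda>w. w \<in> C) p"
  shows "0 \<le> (g + r *\<^sub>R (p - q) + \<mu> *\<^sub>R p) \<bullet> (z - p)"
proof (rule constrained_minimum_variational[OF assms(1) _ assms(2)])
  let ?\<phi> = "\<lambda>w. g \<bullet> w + r / 2 * (norm (w - q))\<^sup>2 + \<mu> / 2 * (norm w)\<^sup>2"
  show "p \<in> C" using assms(3) by (simp add: is_arg_min_def)
  show "?\<phi> p \<le> ?\<phi> w" if "w \<in> C" for w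
    using assms(3) that by (force simp: is_arg_min_def not_less)
  show "?\<phi> (p + d) \<le> ?\<phi> p + (g + r *\<^sub>R (p - q) + \<mu> *\<^sub>R p) \<bullet> d + (r + \<mu>) / 2 * (norm d)\<^sup>2" for d
    unfolding power2_norm_eq_inner by (simp add: field_simps inner_simps inner_commute)
qed

lemma smooth_minimum_variational:
  fixes f :: "'a::euclidean_space \<Rightarrow> real"
  assumes "smooth L f" "convex C" "p \<in> C" "z \<in> C"
    and min: "\<And>w. w \<in> C \<Longrightarrow> f p + b \<bullet> p \<le> f w + b \<bullet> w"
  shows "0 \<le> (grad f p + b) \<bullet> (z - p)"
proof (rule constrained_minimum_variational[where \<phi> = "\<lambda>w. f w + b \<bullet> w", OF assms(2-4) min])
  show "f (p + d) + b \<bullet> (p + d) \<le> f p + b \<bullet> p + (grad f p + b) \<bullet> d + L / 2 * (norm d)\<^sup>2" for d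
    using smooth_bregman_le[OF assms(1), of "p + d" p]
    by (simp add: bregman_def inner_simps)
qed

section \<open>Progress of one block of variables\<close>

text \<open>
  The \<open>x\<close>-part and the \<open>y\<close>-part of LPD are the same iteration and differ only in the
  linear term \<open>b k\<close>, through which the other part enters; \<open>bs\<close> is the value of that term at the
  saddle point. Here \<open>a\<close> is the reciprocal of the averaging step size, \<open>r\<close> that of
  the proximal step size, and \<open>p\<close> is the averaged sequence. The condition \<open>step\<close> is the
  variational inequality of the proximal step.
\<close>

locale lpd_block =
  fixes C :: "'a::euclidean_space set" and f :: "'a \<Rightarrow> real"
    and L \<mu> a c \<kappa> \<theta> r :: real
    and x p b :: "nat \<Rightarrow> 'a" and xs bs :: 'a
  assumes smooth: "smooth L f" and convex: "strongly_convex \<mu> f"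
    and mu: "0 < \<mu>" and a: "a = sqrt (L / \<mu> - 1)" and c: "0 \<le> c"
    and kappa: "0 < \<kappa>" "a + c \<le> \<kappa>" and theta: "\<theta> = \<kappa> / (1 + \<kappa>)"
    and r: "r = \<mu> * (a + c)"
    and iterate_mem: "\<And>k. x (k + 1) \<in> C"
    and xs_mem: "xs \<in> C"
    and xs_opt: "\<And>z. z \<in> C \<Longrightarrow> 0 \<le> (grad f xs + bs) \<bullet> (z - xs)"
    and start: "p 0 = x 0"
    and step: "\<And>k z. z \<in> C \<Longrightarrow>
      0 \<le> (b k + (grad (lower \<mu> f) (p k)
                   + \<theta> *\<^sub>R (grad (lower \<mu> f) (p k) - grad (lower \<mu> f) (p (k - 1))))
           + r *\<^sub>R (x (k + 1) - x k) + \<mu> *\<^sub>R x (k + 1)) \<bullet> (z - x (k + 1))"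
    and average: "\<And>k. p (k + 1) = (1 / (a + 1)) *\<^sub>R (a *\<^sub>R p k + x (k + 1))"
begin

abbreviation F :: "'a \<Rightarrow> real" where "F \<equiv> lower \<mu> f"
abbreviation u :: "nat \<Rightarrow> 'a" where "u k \<equiv> grad F (p k)"

definition energy :: "nat \<Rightarrow> real" where
  "energy k = r / 2 * (norm (x k - xs))\<^sup>2 + a * bregman F (p k) xs"

text \<open>
  The second term is the telescoping product of the increment of \<open>u\<close> with the error. The third
  term is what the averaging step has gained, saved up to pay for that increment in the next step.
  Since \<open>0 - 1 = 0\<close>, both vanish at the start.
\<close>

definition lyapunov :: "nat \<Rightarrow> real" where
  "lyapunov k = energy k / \<theta> - (u k - u (k - 1)) \<bullet> (x k - xs) + a * bregman F (p (k - 1)) (p k)"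

lemma a_nonneg: "0 \<le> a"
  using strong_convexity_le_smoothness[OF smooth convex] mu by (simp add: a)

lemma smoothness_eq: "L - \<mu> = \<mu> * a\<^sup>2"
  using strong_convexity_le_smoothness[OF smooth convex] mu by (simp add: a algebra_simps)

lemma theta_bounds: "0 < \<theta>" "\<theta> \<le> 1"
  using kappa by (auto simp: theta)

lemma energy_nonneg: "0 \<le> energy k"
  using a_nonneg c mu bregman_lower_nonneg[OF smooth convex] unfolding energy_def by (simp add: r)

lemma energy_div_theta_ge: "energy k \<le> energy k / \<theta>"
  using energy_nonneg theta_bounds by (simp add: le_divide_eq mult_left_le)

lemma grad_diff_inner_le:
  "(u k - u (k - 1)) \<bullet> z \<le> a * bregman F (p (k - 1)) (p k) + \<mu> * a / 2 * (norm z)\<^sup>2"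
proof -
  \<comment> \<open>The sign is moved to \<open>z\<close> so that the older point comes first in the Bregman distance, as in \<open>lyapunov\<close>.\<close>
  have "(grad F (p (k - 1)) - grad F (p k)) \<bullet> (- z)
      \<le> a * bregman F (p (k - 1)) (p k) + \<mu> * a / 2 * (norm (- z))\<^sup>2"
    using bregman_lower_nonneg[OF smooth convex] bregman_lower_le[OF smooth, of \<mu>] a_nonneg
    by (intro grad_diff_inner_le_bregman) (simp_all add: smoothness_eq)
  then show ?thesis by (simp add: inner_diff_left)
qed

text \<open>
  The share \<open>\<mu> a\<close> of \<open>r\<close> compensates the indefinite product in \<open>lyapunov\<close>; the share \<open>\<mu> c\<close>
  survives.
\<close>

lemma lyapunov_lower: "\<mu> * c / 2 * (norm (x k - xs))\<^sup>2 \<le> lyapunov k"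
proof -
  have "\<mu> * c / 2 * (norm (x k - xs))\<^sup>2 + \<mu> * a / 2 * (norm (x k - xs))\<^sup>2 \<le> energy k"
    using a_nonneg bregman_lower_nonneg[OF smooth convex, of "p k" xs]
    unfolding energy_def by (simp add: r algebra_simps add_divide_distrib)
  then show ?thesis
    using energy_div_theta_ge[of k] grad_diff_inner_le[of k "x k - xs"]
    unfolding lyapunov_def by linarith
qed

lemma lyapunov_0:
  "lyapunov 0 \<le> (r / 2 + (L - \<mu>) * a / 2) * (norm (x 0 - xs))\<^sup>2 / \<theta>"
proof -
  have "a * bregman F (p 0) xs \<le> a * ((L - \<mu>) / 2 * (norm (x 0 - xs))\<^sup>2)"
    using bregman_lower_le[OF smooth, of \<mu> "p 0" xs] a_nonneg
    by (intro mult_left_mono) (simp_all add: start)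
  then have "energy 0 \<le> (r / 2 + (L - \<mu>) * a / 2) * (norm (x 0 - xs))\<^sup>2"
    by (simp add: energy_def algebra_simps)
  then have "energy 0 / \<theta> \<le> (r / 2 + (L - \<mu>) * a / 2) * (norm (x 0 - xs))\<^sup>2 / \<theta>"
    using theta_bounds by (intro divide_right_mono) auto
  then show ?thesis by (simp add: lyapunov_def bregman_def)
qed

text \<open>
  The strong convexity gained in one step is worth the factor \<open>1/\<theta> = 1 + 1/\<kappa>\<close>, because neither \<open>r / \<mu> = a + c\<close> nor
  \<open>a\<close> exceeds \<open>\<kappa>\<close>.
\<close>

lemma energy_growth:
  "energy (k + 1) / \<theta>
    \<le> (r / 2 + \<mu>) * (norm (x (k + 1) - xs))\<^sup>2 + (1 + a) * bregman F (p (k + 1)) xs"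
proof -
  have inv: "1 / \<theta> = 1 + 1 / \<kappa>" using kappa by (simp add: theta field_simps)
  have "r / 2 / \<kappa> \<le> \<mu>"
    using kappa mu a_nonneg c by (simp add: r divide_le_eq mult_left_mono)
  then have 1: "(r / 2 * (1 / \<theta>)) * (norm (x (k + 1) - xs))\<^sup>2
      \<le> (r / 2 + \<mu>) * (norm (x (k + 1) - xs))\<^sup>2"
    by (intro mult_right_mono) (auto simp: inv algebra_simps)
  have "a / \<kappa> \<le> 1" using kappa c by (simp add: divide_le_eq)
  then have 2: "(a * (1 / \<theta>)) * bregman F (p (k + 1)) xs \<le> (1 + a) * bregman F (p (k + 1)) xs"
    using bregman_lower_nonneg[OF smooth convex] by (intro mult_right_mono) (auto simp: inv algebra_simps)
  have "energy (k + 1) / \<theta> = (r / 2 * (1 / \<theta>)) * (norm (x (k + 1) - xs))\<^sup>2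
      + (a * (1 / \<theta>)) * bregman F (p (k + 1)) xs"
    by (simp add: energy_def add_divide_distrib)
  with 1 2 show ?thesis by linarith
qed

text \<open>
  The force term on the left is left to be cancelled against the other block, and the squared increment
  weighted by \<open>\<mu> c / 2\<close> is kept in reserve for the products of increments coupled by \<open>A\<close>.
\<close>

lemma lyapunov_step:
  "lyapunov (k + 1) + \<mu> * c / 2 * (norm (x (k + 1) - x k))\<^sup>2 + (b k - bs) \<bullet> (x (k + 1) - xs)
    \<le> \<theta> * lyapunov k"
proof -
  define e where "e = x (k + 1) - xs"
  define d where "d = x (k + 1) - x k"
  define du where "du = u k - u (k - 1)"
  define du' where "du' = u (k + 1) - u k"
  have xk: "x k - xs = e - d" by (simp add: e_def d_def)
  have opt: "0 \<le> (grad F xs + \<mu> *\<^sub>R xs + bs) \<bullet> e"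
    using xs_opt[OF iterate_mem[of k]] by (simp add: e_def grad_lower[OF smooth])
  have "(b k + (u k + \<theta> *\<^sub>R du) + r *\<^sub>R d + \<mu> *\<^sub>R x (k + 1)) \<bullet> e \<le> 0"
    using step[OF xs_mem, of k] by (simp add: e_def d_def du_def inner_simps)
  with opt have "(b k - bs) \<bullet> e + (u k - grad F xs) \<bullet> e + \<theta> * (du \<bullet> e) + r * (d \<bullet> e) + \<mu> * (e \<bullet> e) \<le> 0"
    by (simp add: e_def inner_simps algebra_simps)
  \<comment> \<open>The averaging step controls the new gradient, so the extrapolated one is compared with it.\<close>
  moreover have "(u k - grad F xs) \<bullet> e = (u (k + 1) - grad F xs) \<bullet> e - du' \<bullet> e"
    by (simp add: du'_def inner_diff_left)
  moreover have "(u (k + 1) - grad F xs) \<bullet> e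
      \<ge> (1 + a) * bregman F (p (k + 1)) xs - a * bregman F (p k) xs
        + a * bregman F (p k) (p (k + 1))"
  proof -
    have "(a + 1) *\<^sub>R p (k + 1) = a *\<^sub>R p k + x (k + 1)"
      using a_nonneg average[of k] by simp
    from bregman_averaging[OF this, of xs F] show ?thesis
      using bregman_lower_nonneg[OF smooth convex, of xs "p (k + 1)"]
      by (simp add: e_def inner_commute)
  qed
  \<comment> \<open>The mismatch of the extrapolation, a product of two increments.\<close>
  moreover have "\<theta> * (du \<bullet> (- d))
      \<le> \<theta> * (a * bregman F (p (k - 1)) (p k)) + \<mu> * a / 2 * (norm d)\<^sup>2"
  proof -
    have "\<theta> * (du \<bullet> (- d)) \<le> \<theta> * (a * bregman F (p (k - 1)) (p k) + \<mu> * a / 2 * (norm (- d))\<^sup>2)"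
      unfolding du_def using theta_bounds by (intro mult_left_mono grad_diff_inner_le) auto
    also have "\<dots> \<le> \<theta> * (a * bregman F (p (k - 1)) (p k)) + 1 * (\<mu> * a / 2 * (norm d)\<^sup>2)"
      unfolding distrib_left norm_minus_cancel using theta_bounds mu a_nonneg
      by (intro add_left_mono mult_right_mono) auto
    finally show ?thesis by simp
  qed
  moreover have "r * (d \<bullet> e) = r / 2 * (norm d)\<^sup>2 + r / 2 * (norm e)\<^sup>2 - r / 2 * (norm (e - d))\<^sup>2"
    unfolding power2_norm_eq_inner by (simp add: inner_simps inner_commute algebra_simps)
  moreover have "r / 2 * (norm d)\<^sup>2 = \<mu> * c / 2 * (norm d)\<^sup>2 + \<mu> * a / 2 * (norm d)\<^sup>2"
    by (simp add: r algebra_simps add_divide_distrib)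
  moreover have "energy (k + 1) / \<theta>
      \<le> r / 2 * (norm e)\<^sup>2 + \<mu> * (e \<bullet> e) + (1 + a) * bregman F (p (k + 1)) xs"
    using energy_growth[of k] by (simp add: e_def power2_norm_eq_inner algebra_simps)
  moreover have "energy k = r / 2 * (norm (e - d))\<^sup>2 + a * bregman F (p k) xs"
    by (simp add: energy_def xk)
  moreover have "\<theta> * lyapunov k = energy k - \<theta> * (du \<bullet> e) - \<theta> * (du \<bullet> (- d))
      + \<theta> * (a * bregman F (p (k - 1)) (p k))"
    unfolding lyapunov_def xk du_def[symmetric] using theta_bounds
    by (simp add: inner_diff_right distrib_left right_diff_distrib)
  moreover have "lyapunov (k + 1) = energy (k + 1) / \<theta> - du' \<bullet> e + a * bregman F (p k) (p (k + 1))"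
    by (simp add: lyapunov_def e_def du'_def)
  ultimately show ?thesis
    unfolding e_def[symmetric] d_def[symmetric] by linarith
qed

end

section \<open>Coupling the two blocks\<close>

lemma transpose_mult_inner:
  fixes A :: "real^'n^'m"
  shows "(transpose A *v y) \<bullet> x = y \<bullet> (A *v x)"
  by (simp add: dot_lmul_matrix)

text \<open>
  Since \<open>\<parallel>A\<parallel> = (c/2) sqrt (\<mu>\<^sub>x \<mu>\<^sub>y)\<close>, this is Cauchy-Schwarz followed by the arithmetic-geometric
  mean inequality in the norms scaled by \<open>sqrt \<mu>\<^sub>x\<close> and \<open>sqrt \<mu>\<^sub>y\<close>.
\<close>

lemma coupling_le:
  fixes A :: "real^'n^'m"
  assumes mu: "0 < \<mu>x" "0 < \<mu>y"
    and c: "c = 2 * onorm (\<lambda>v. A *v v) / sqrt (\<mu>x * \<mu>y)"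
  shows "\<bar>v \<bullet> (A *v w)\<bar> \<le> c / 4 * (\<mu>x * (norm w)\<^sup>2 + \<mu>y * (norm v)\<^sup>2)"
proof -
  have c0: "0 \<le> c"
    using mu onorm_pos_le[OF matrix_vector_mul_bounded_linear[of A]] by (simp add: c)
  have "onorm (\<lambda>v. A *v v) = c / 2 * (sqrt \<mu>x * sqrt \<mu>y)"
    using mu by (simp add: c real_sqrt_mult)
  with onorm[OF matrix_vector_mul_bounded_linear[of A], of w]
  have "norm (A *v w) \<le> c / 2 * (sqrt \<mu>x * sqrt \<mu>y) * norm w" by metis
  then have "norm v * norm (A *v w) \<le> norm v * (c / 2 * (sqrt \<mu>x * sqrt \<mu>y) * norm w)"
    by (rule mult_left_mono) simp
  then have "\<bar>v \<bullet> (A *v w)\<bar> \<le> c / 4 * (2 * (sqrt \<mu>x * norm w) * (sqrt \<mu>y * norm v))"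
    using Cauchy_Schwarz_ineq2[of v "A *v w"] by (simp add: mult_ac)
  also have "\<dots> \<le> c / 4 * ((sqrt \<mu>x * norm w)\<^sup>2 + (sqrt \<mu>y * norm v)\<^sup>2)"
    using c0 by (intro mult_left_mono sum_squares_bound) auto
  finally show ?thesis using mu by (simp add: power_mult_distrib)
qed

locale lpd_pair =
  primal: lpd_block X f Lx \<mu>x ax c \<kappa> \<theta> rx x xl
    "\<lambda>k. transpose A *v (y k + \<theta> *\<^sub>R (y k - y (k - 1)))" xs "transpose A *v ys" +
  dual: lpd_block Y h Ly \<mu>y ay c \<kappa> \<theta> ry y yl
    "\<lambda>k. - (A *v (x k + \<theta> *\<^sub>R (x k - x (k - 1))))" ys "- (A *v xs)"
  for X :: "(real^'n) set" and Y :: "(real^'m) set" and A :: "real^'n^'m"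
    and f h Lx Ly \<mu>x \<mu>y ax ay c \<kappa> \<theta> rx ry x xl y yl xs ys +
  assumes coupling: "c = 2 * onorm (\<lambda>v. A *v v) / sqrt (\<mu>x * \<mu>y)"
begin

text \<open>
  The part of the bilinear coupling that telescopes at the rate \<open>\<theta>\<close>. The sign differs between
  the two products because \<open>A\<close> enters the dual block with a minus sign.
\<close>

definition cross :: "nat \<Rightarrow> real" where
  "cross k = (y k - ys) \<bullet> (A *v (x k - x (k - 1))) - (y k - y (k - 1)) \<bullet> (A *v (x k - xs))"

definition move :: "nat \<Rightarrow> real" where
  "move k = \<mu>x * (norm (x k - x (k - 1)))\<^sup>2 + \<mu>y * (norm (y k - y (k - 1)))\<^sup>2"

text \<open>
  Half of the reserve \<open>c / 2 * move k\<close> left by the two blocks is saved for the next step, where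
  it bounds the older increments in the products of consecutive ones; the other half bounds the newer increments.
\<close>

definition potential :: "nat \<Rightarrow> real" where
  "potential k = primal.lyapunov k + dual.lyapunov k + cross k + c / 4 * move k"

lemmas bilinear_le = coupling_le[OF primal.mu dual.mu coupling]

lemma potential_lower:
  "c / 4 * (\<mu>x * (norm (x k - xs))\<^sup>2 + \<mu>y * (norm (y k - ys))\<^sup>2) \<le> potential k"
  using primal.lyapunov_lower[of k] dual.lyapunov_lower[of k]
    bilinear_le[of "y k - ys" "x k - x (k - 1)"] bilinear_le[of "y k - y (k - 1)" "x k - xs"]
  unfolding potential_def cross_def move_def distrib_left abs_le_iff by argo

text \<open>
  The contributions of the current iterates cancel because \<open>A\<close> enters the two blocks with opposite
  signs. What the extrapolation misses is the telescoping part and products of two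
  consecutive increments.
\<close>

lemma forces_eq:
  "(transpose A *v (y k + \<theta> *\<^sub>R (y k - y (k - 1))) - transpose A *v ys) \<bullet> (x (k + 1) - xs)
    + (- (A *v (x k + \<theta> *\<^sub>R (x k - x (k - 1)))) - - (A *v xs)) \<bullet> (y (k + 1) - ys)
   = cross (k + 1) - \<theta> * cross k
    + \<theta> * ((y k - y (k - 1)) \<bullet> (A *v (x (k + 1) - x k)))
    - \<theta> * ((y (k + 1) - y k) \<bullet> (A *v (x k - x (k - 1))))"
  unfolding cross_def inner_diff_left transpose_mult_inner
  by (simp add: inner_simps matrix_vector_mult_diff_distrib matrix_vector_right_distrib
      matrix_vector_mult_scaleR inner_commute algebra_simps)

lemma potential_step: "potential (k + 1) \<le> \<theta> * potential k"
proof -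
  have "\<theta> * ((y (k + 1) - y k) \<bullet> (A *v (x k - x (k - 1))))
      - \<theta> * ((y k - y (k - 1)) \<bullet> (A *v (x (k + 1) - x k)))
      \<le> \<theta> * (c / 4 * move (k + 1) + c / 4 * move k)"
    unfolding right_diff_distrib[symmetric]
    using bilinear_le[of "y (k + 1) - y k" "x k - x (k - 1)"]
      bilinear_le[of "y k - y (k - 1)" "x (k + 1) - x k"] primal.theta_bounds
    by (intro mult_left_mono) (auto simp: move_def distrib_left abs_le_iff)
  also have "\<dots> \<le> c / 4 * move (k + 1) + \<theta> * (c / 4 * move k)"
    using mult_right_mono[of \<theta> 1 "c / 4 * move (k + 1)"]
      primal.theta_bounds primal.c primal.mu dual.mu
    by (simp add: distrib_left move_def)
  finally have cross_bound:
    "\<theta> * ((y (k + 1) - y k) \<bullet> (A *v (x k - x (k - 1))))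
      - \<theta> * ((y k - y (k - 1)) \<bullet> (A *v (x (k + 1) - x k)))
      \<le> c / 4 * move (k + 1) + \<theta> * (c / 4 * move k)" .
  have "c / 2 * move (k + 1) = \<mu>x * c / 2 * (norm (x (k + 1) - x k))\<^sup>2
      + \<mu>y * c / 2 * (norm (y (k + 1) - y k))\<^sup>2"
    by (simp add: move_def algebra_simps add_divide_distrib)
  moreover have "\<theta> * potential k = \<theta> * primal.lyapunov k + \<theta> * dual.lyapunov k
      + \<theta> * cross k + \<theta> * (c / 4 * move k)"
    by (simp add: potential_def distrib_left)
  moreover have "potential (k + 1)
      = primal.lyapunov (k + 1) + dual.lyapunov (k + 1) + cross (k + 1) + c / 4 * move (k + 1)"
    by (rule potential_def)
  ultimately show ?thesis
    using primal.lyapunov_step[of k] dual.lyapunov_step[of k] cross_bound forces_eq[of k]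
    by linarith
qed

lemma potential_decay: "potential k \<le> \<theta> ^ k * potential 0"
proof (induction k)
  case (Suc k)
  have "potential (Suc k) \<le> \<theta> * potential k" using potential_step[of k] by simp
  also have "\<dots> \<le> \<theta> * (\<theta> ^ k * potential 0)"
    using Suc.IH primal.theta_bounds by (intro mult_left_mono) auto
  finally show ?case by (simp add: mult.assoc)
qed simp

lemma distance_decay:
  assumes "0 < K"
  shows "c / 4 * (\<mu>x * (norm (x K - xs))\<^sup>2 + \<mu>y * (norm (y K - ys))\<^sup>2)
    \<le> \<theta> ^ (K - 1) * ((rx / 2 + (Lx - \<mu>x) * ax / 2) * (norm (x 0 - xs))\<^sup>2
                       + (ry / 2 + (Ly - \<mu>y) * ay / 2) * (norm (y 0 - ys))\<^sup>2)"
    (is "_ \<le> _ * ?R")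
proof -
  have "potential 0 \<le> ?R / \<theta>"
    using primal.lyapunov_0 dual.lyapunov_0
    by (simp add: potential_def cross_def move_def add_divide_distrib)
  then have "\<theta> ^ K * potential 0 \<le> \<theta> ^ K * (?R / \<theta>)"
    using primal.theta_bounds by (intro mult_left_mono) auto
  also have "\<dots> = \<theta> ^ (K - 1) * ?R"
    using assms primal.theta_bounds by (cases K) auto
  finally show ?thesis using potential_lower[of K] potential_decay[of K] by linarith
qed

end

section \<open>Linear convergence of LPD\<close>

lemma contraction_power_le_exp:
  fixes \<kappa> :: real
  assumes "0 \<le> \<kappa>" "0 < K"
  shows "(\<kappa> / (1 + \<kappa>)) ^ (K - 1) \<le> exp (- ((real K - 1) / (\<kappa> + 1)))"
proof -
  have "\<kappa> / (1 + \<kappa>) = 1 + - (1 / (\<kappa> + 1))" using assms by (simp add: field_simps)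
  also have "\<dots> \<le> exp (- (1 / (\<kappa> + 1)))" by (rule exp_ge_add_one_self)
  finally have "(\<kappa> / (1 + \<kappa>)) ^ (K - 1) \<le> exp (- (1 / (\<kappa> + 1))) ^ (K - 1)"
    using assms by (intro power_mono) auto
  also have "\<dots> = exp (- ((real K - 1) / (\<kappa> + 1)))"
    using assms by (simp add: exp_of_nat_mult[symmetric] of_nat_diff)
  finally show ?thesis .
qed

theorem corollary2:
  fixes X :: "(real^'n) set" and Y :: "(real^'m) set" and A :: "real^'n^'m"
    and f :: "real^'n \<Rightarrow> real" and h :: "real^'m \<Rightarrow> real"
    and Lx Ly \<mu>x \<mu>y normA \<kappa> \<theta> rx ry ru rv :: real
    and xs :: "real^'n" and ys :: "real^'m"
    and x xl :: "nat \<Rightarrow> real^'n" and y yl :: "nat \<Rightarrow> real^'m"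
    and K :: nat
  assumes X: "X \<noteq> {}" "closed X" "convex X"
    and Y: "Y \<noteq> {}" "closed Y" "convex Y"
    and mu: "\<mu>x > 0" "\<mu>y > 0"
    and f: "smooth Lx f" "strongly_convex \<mu>x f"
    and h: "smooth Ly h" "strongly_convex \<mu>y h"
    and saddle: "saddle_point X Y (bilinear_payoff f h A) xs ys"
    and normA: "normA = onorm (\<lambda>v. A *v v)"
    and kappa: "\<kappa> = sqrt (Lx / \<mu>x - 1) + 2 * normA / sqrt (\<mu>x * \<mu>y) + sqrt (Ly / \<mu>y - 1)"
    and theta: "\<theta> = \<kappa> / (1 + \<kappa>)"
    and rx: "rx = \<mu>x * (sqrt (Lx / \<mu>x - 1) + 2 * normA / sqrt (\<mu>x * \<mu>y))"
    and ry: "ry = \<mu>y * (sqrt (Ly / \<mu>y - 1) + 2 * normA / sqrt (\<mu>x * \<mu>y))"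
    and ru: "ru = sqrt (Lx / \<mu>x - 1)"
    and rv: "rv = sqrt (Ly / \<mu>y - 1)"
    and lpd: "lpd_iterates X Y A f h \<mu>x \<mu>y (\<lambda>_. \<theta>) (\<lambda>_. rx) (\<lambda>_. ry) (\<lambda>_. ru) (\<lambda>_. rv) x y xl yl"
    and K: "K > 0"
  shows "normA / sqrt (\<mu>x * \<mu>y) *
           (\<mu>x / 2 * (norm (xs - x K))\<^sup>2 + \<mu>y / 2 * (norm (ys - y K))\<^sup>2)
         \<le> exp (- ((real K - 1) / (\<kappa> + 1))) *
           ((rx / 2 + (Lx - \<mu>x) * ru / 2) * (norm (xs - x 0))\<^sup>2
            + (ry / 2 + (Ly - \<mu>y) * rv / 2) * (norm (ys - y 0))\<^sup>2)"
proof -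
  define c where "c = 2 * normA / sqrt (\<mu>x * \<mu>y)"
  have c: "0 \<le> c"
    using mu onorm_pos_le[OF matrix_vector_mul_bounded_linear[of A]] by (simp add: c_def normA)
  have L: "\<mu>x \<le> Lx" "\<mu>y \<le> Ly"
    using strong_convexity_le_smoothness f h by blast+
  then have nonneg: "0 \<le> ru" "0 \<le> rv" using mu by (simp_all add: ru rv)
  have params: "rx = \<mu>x * (ru + c)" "ry = \<mu>y * (rv + c)" "\<kappa> = ru + c + rv"
    by (simp_all add: rx ry ru rv kappa c_def)
  let ?R = "(rx / 2 + (Lx - \<mu>x) * ru / 2) * (norm (xs - x 0))\<^sup>2
            + (ry / 2 + (Ly - \<mu>y) * rv / 2) * (norm (ys - y 0))\<^sup>2"
  have R: "0 \<le> ?R" using c nonneg L mu by (simp add: params(1,2))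
  \<comment> \<open>For \<open>c = 0\<close> it may happen that \<open>\<kappa> = \<theta> = 0\<close>, where the energy cannot be divided by \<open>\<theta>\<close>.\<close>
  show ?thesis
  proof (cases "c = 0")
    case True
    then have "normA = 0" using mu by (simp add: c_def)
    with R show ?thesis by simp
  next
    case False
    with c nonneg have kappa_pos: "0 < \<kappa>" by (simp add: params(3))
    define xt where "xt k = x k + \<theta> *\<^sub>R (x k - x (k - 1))" for k
    define yt where "yt k = y k + \<theta> *\<^sub>R (y k - y (k - 1))" for k
    define gx where "gx k = grad (lower \<mu>x f) (xl k)
      + \<theta> *\<^sub>R (grad (lower \<mu>x f) (xl k) - grad (lower \<mu>x f) (xl (k - 1)))" for k
    define gy where "gy k = grad (lower \<mu>y h) (yl k)
      + \<theta> *\<^sub>R (grad (lower \<mu>y h) (yl k) - grad (lower \<mu>y h) (yl (k - 1)))" for k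
    have start: "xl 0 = x 0" "yl 0 = y 0"
      and xstep: "\<And>k. is_arg_min
        (\<lambda>z. (transpose A *v yt k + gx k) \<bullet> z + rx / 2 * (norm (z - x k))\<^sup>2 + \<mu>x / 2 * (norm z)\<^sup>2)
        (\<lambda>z. z \<in> X) (x (k + 1))"
      and ystep: "\<And>k. is_arg_min
        (\<lambda>z. - ((A *v xt k - gy k) \<bullet> z) + ry / 2 * (norm (z - y k))\<^sup>2 + \<mu>y / 2 * (norm z)\<^sup>2)
        (\<lambda>z. z \<in> Y) (y (k + 1))"
      and average: "\<And>k. xl (k + 1) = (1 / (ru + 1)) *\<^sub>R (ru *\<^sub>R xl k + x (k + 1))"
        "\<And>k. yl (k + 1) = (1 / (rv + 1)) *\<^sub>R (rv *\<^sub>R yl k + y (k + 1))"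
      using lpd unfolding lpd_iterates_def Let_def xt_def yt_def gx_def gy_def by blast+
    have ystep': "is_arg_min
        (\<lambda>z. (- (A *v xt k) + gy k) \<bullet> z + ry / 2 * (norm (z - y k))\<^sup>2 + \<mu>y / 2 * (norm z)\<^sup>2)
        (\<lambda>z. z \<in> Y) (y (k + 1))" for k
    proof -
      have "- ((A *v xt k - gy k) \<bullet> z) = (- (A *v xt k) + gy k) \<bullet> z" for z
        by (simp add: inner_simps)
      with ystep[of k] show ?thesis by simp
    qed
    have mem: "xs \<in> X" "ys \<in> Y" using saddle by (simp_all add: saddle_point_def)
    have xmin: "f xs + (transpose A *v ys) \<bullet> xs \<le> f w + (transpose A *v ys) \<bullet> w" if "w \<in> X" for w
      unfolding transpose_mult_inner
      using saddle that mem by (fastforce simp: saddle_point_def bilinear_payoff_def)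
    have ymin: "h ys + (- (A *v xs)) \<bullet> ys \<le> h w + (- (A *v xs)) \<bullet> w" if "w \<in> Y" for w
      using saddle that mem by (fastforce simp: saddle_point_def bilinear_payoff_def inner_commute)
    interpret lpd_pair X Y A f h Lx Ly \<mu>x \<mu>y ru rv c \<kappa> \<theta> rx ry x xl y yl xs ys
    proof unfold_locales
      show "x (k + 1) \<in> X" "y (k + 1) \<in> Y" for k
        using xstep[of k] ystep[of k] by (simp_all add: is_arg_min_def)
      show "0 \<le> (grad f xs + transpose A *v ys) \<bullet> (z - xs)" if "z \<in> X" for z
        using smooth_minimum_variational[OF f(1) X(3) mem(1) that xmin] .
      show "0 \<le> (grad h ys + - (A *v xs)) \<bullet> (z - ys)" if "z \<in> Y" for z
        using smooth_minimum_variational[OF h(1) Y(3) mem(2) that ymin] .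
    next
      fix k z assume "z \<in> X"
      from prox_variational[OF X(3) this xstep[of k]]
      show "0 \<le> (transpose A *v (y k + \<theta> *\<^sub>R (y k - y (k - 1)))
          + (grad (lower \<mu>x f) (xl k)
             + \<theta> *\<^sub>R (grad (lower \<mu>x f) (xl k) - grad (lower \<mu>x f) (xl (k - 1))))
          + rx *\<^sub>R (x (k + 1) - x k) + \<mu>x *\<^sub>R x (k + 1)) \<bullet> (z - x (k + 1))"
        unfolding yt_def gx_def .
    next
      fix k z assume "z \<in> Y"
      from prox_variational[OF Y(3) this ystep'[of k]]
      show "0 \<le> (- (A *v (x k + \<theta> *\<^sub>R (x k - x (k - 1))))
          + (grad (lower \<mu>y h) (yl k)
             + \<theta> *\<^sub>R (grad (lower \<mu>y h) (yl k) - grad (lower \<mu>y h) (yl (k - 1))))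
          + ry *\<^sub>R (y (k + 1) - y k) + \<mu>y *\<^sub>R y (k + 1)) \<bullet> (z - y (k + 1))"
        unfolding xt_def gy_def .
    qed (use f h mu c nonneg kappa_pos mem start average in
          \<open>simp_all add: params theta ru[symmetric] rv[symmetric] c_def normA\<close>)
    have "normA / sqrt (\<mu>x * \<mu>y) *
           (\<mu>x / 2 * (norm (xs - x K))\<^sup>2 + \<mu>y / 2 * (norm (ys - y K))\<^sup>2)
        = c / 4 * (\<mu>x * (norm (x K - xs))\<^sup>2 + \<mu>y * (norm (y K - ys))\<^sup>2)"
      by (simp add: c_def norm_minus_commute field_simps)
    also have "\<dots> \<le> \<theta> ^ (K - 1) * ?R"
      using distance_decay[OF K] by (simp add: norm_minus_commute)
    also have "\<dots> \<le> exp (- ((real K - 1) / (\<kappa> + 1))) * ?R"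
      using contraction_power_le_exp[of \<kappa> K] kappa_pos K R unfolding theta
      by (intro mult_right_mono) auto
    finally show ?thesis .
  qed
qed

end
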